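(* For a linear map $\Omega:\mathbb{F}[x]\to\mathbb{F}[x]$ let $\psi_1:\mathbb{F}[x]\times H_3\to\mathbb{F}[x]$ be the bilinear map with $\psi_1(p,\overline{1})=\Omega(p)$, $\psi_1(p,\overline{x})=xp$, $\psi_1(p,\frac{\overline{\delta}}{\delta x})=\frac{\delta}{\delta x}p$. The Leibniz algebras obtained from the action $\psi_1$ — that is, the Leibniz algebras $L$ with $L/I\cong H_3$ for which, for some linear $\Omega$ such that $\psi_1$ makes $\mathbb{F}[x]$ an $H_3$-module, the $H_3$-module $I$ is isomorphic to $(\mathbb{F}[x],\psi_1)$ — are, up to isomorphism, the same as the Heisenberg-Fock Leibniz algebra $HFL_3$, i.e. the algebra with basis $\{\overline{1},\overline{x},\frac{\overline{\delta}}{\delta x}\}\,\dot\cup\,\{x^t: t\in\mathbb{N}\cup\{0\}\}$ and products $$[\overline{x},\tfrac{\overline{\delta}}{\delta x}]=\overline{1},\quad [\tfrac{\overline{\delta}}{\delta x},\overline{x}]=-\overline{1},\quad [x^t,\overline{1}]=x^t,\quad [x^t,\overline{x}]=x^{t+1},\quad [x^t,\tfrac{\overline{\delta}}{\delta x}]=t\,x^{t-1},$$ all omitted products of basis elements being zero.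
   Context: $\mathbb{F}$ is an algebraically closed field of characteristic zero. A Leibniz algebra is an $\mathbb{F}$-vector space $L$ with a bilinear product $[\cdot,\cdot]$ satisfying $[[y,z],x]=[[y,x],z]+[y,[z,x]]$ for all $x,y,z\in L$. $I$ denotes the ideal of $L$ generated by $\{[x,x]:x\in L\}$; it satisfies $[L,I]=0$, the quotient $L/I$ is a Lie algebra, and $I$ is a (right) $L/I$-module via $(i,[x])\mapsto [i,x]$. A (right) module $M$ over a Lie algebra $\mathfrak g$ satisfies $m\cdot[a,b]=(m\cdot a)\cdot b-(m\cdot b)\cdot a$. $H_3$ is the Heisenberg Lie algebra with basis $\{\overline{1},\overline{x},\frac{\overline{\delta}}{\delta x}\}$ and nonzero products $[\overline{x},\frac{\overline{\delta}}{\delta x}]=-[\frac{\overline{\delta}}{\delta x},\overline{x}]=\overline{1}$. $\frac{\delta}{\delta x}$ is the usual derivative on $\mathbb{F}[x]$. *)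

theory Defs
  imports
    "HOL-Computational_Algebra.Polynomial"
    "HOL-Library.Product_Plus"
    "HOL-Library.Set_Algebras"
begin

locale leibniz_algebra = vector_space scale
  for scale :: "'k::field \<Rightarrow> 'v::ab_group_add \<Rightarrow> 'v" +
  fixes br :: "'v \<Rightarrow> 'v \<Rightarrow> 'v"
  assumes linear_br_left: "Vector_Spaces.linear scale scale (\<lambda>x. br x y)"
    and linear_br_right: "Vector_Spaces.linear scale scale (br x)"
    and leibniz: "br (br y z) x = br (br y x) z + br y (br z x)"

locale lie_algebra = leibniz_algebra scale br
  for scale :: "'k::field \<Rightarrow> 'v::ab_group_add \<Rightarrow> 'v" and br :: "'v \<Rightarrow> 'v \<Rightarrow> 'v" +
  assumes br_self: "br x x = 0"

locale lie_right_module = lie_algebra scale br + M: vector_space scaleM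
  for scale :: "'k::field \<Rightarrow> 'v::ab_group_add \<Rightarrow> 'v" and br :: "'v \<Rightarrow> 'v \<Rightarrow> 'v"
    and scaleM :: "'k \<Rightarrow> 'm::ab_group_add \<Rightarrow> 'm" +
  fixes act :: "'m \<Rightarrow> 'v \<Rightarrow> 'm"
  assumes linear_act_left: "Vector_Spaces.linear scaleM scaleM (\<lambda>m. act m a)"
    and linear_act_right: "Vector_Spaces.linear scale scaleM (act m)"
    and act_br: "act m (br a b) = act (act m a) b - act (act m b) a"

definition leibniz_iso ::
  "('k::field \<Rightarrow> 'v::ab_group_add \<Rightarrow> 'v) \<Rightarrow> ('v \<Rightarrow> 'v \<Rightarrow> 'v) \<Rightarrow>
   ('k \<Rightarrow> 'w::ab_group_add \<Rightarrow> 'w) \<Rightarrow> ('w \<Rightarrow> 'w \<Rightarrow> 'w) \<Rightarrow> ('v \<Rightarrow> 'w) \<Rightarrow> bool" where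
  "leibniz_iso scale br scale' br' f \<longleftrightarrow>
     Vector_Spaces.linear scale scale' f \<and> bij f \<and> (\<forall>x y. f (br x y) = br' (f x) (f y))"

definition leibniz_isomorphic ::
  "('k::field \<Rightarrow> 'v::ab_group_add \<Rightarrow> 'v) \<Rightarrow> ('v \<Rightarrow> 'v \<Rightarrow> 'v) \<Rightarrow>
   ('k \<Rightarrow> 'w::ab_group_add \<Rightarrow> 'w) \<Rightarrow> ('w \<Rightarrow> 'w \<Rightarrow> 'w) \<Rightarrow> bool" where
  "leibniz_isomorphic scale br scale' br' \<longleftrightarrow> (\<exists>f. leibniz_iso scale br scale' br' f)"


definition leibniz_ideal ::
  "('k::field \<Rightarrow> 'v::ab_group_add \<Rightarrow> 'v) \<Rightarrow> ('v \<Rightarrow> 'v \<Rightarrow> 'v) \<Rightarrow> 'v set \<Rightarrow> bool" where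
  "leibniz_ideal scale br J \<longleftrightarrow>
     module.subspace scale J \<and> (\<forall>j\<in>J. \<forall>x. br j x \<in> J \<and> br x j \<in> J)"

definition squares_ideal ::
  "('k::field \<Rightarrow> 'v::ab_group_add \<Rightarrow> 'v) \<Rightarrow> ('v \<Rightarrow> 'v \<Rightarrow> 'v) \<Rightarrow> 'v set" where
  "squares_ideal scale br = \<Inter>{J. leibniz_ideal scale br J \<and> (\<forall>x. br x x \<in> J)}"


text \<open>The quotient by an ideal \<open>J\<close> lives on the set of cosets \<open>x +o J\<close>; its addition is the
  elementwise sum of cosets. Scaling and bracketing cosets elementwise need not give full cosets
  (e.g. for the scalar \<open>0\<close>), hence the summand \<open>J\<close>.\<close>

definition quot_carrier :: "'v::ab_group_add set \<Rightarrow> 'v set set" where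
  "quot_carrier J = range (\<lambda>x. x +o J)"

definition quot_scale ::
  "('k \<Rightarrow> 'v::ab_group_add \<Rightarrow> 'v) \<Rightarrow> 'v set \<Rightarrow> 'k \<Rightarrow> 'v set \<Rightarrow> 'v set" where
  "quot_scale scale J c A = scale c ` A + J"

definition quot_br ::
  "('v::ab_group_add \<Rightarrow> 'v \<Rightarrow> 'v) \<Rightarrow> 'v set \<Rightarrow> 'v set \<Rightarrow> 'v set \<Rightarrow> 'v set" where
  "quot_br br J A B = {br a b | a b. a \<in> A \<and> b \<in> B} + J"

definition quot_iso ::
  "('k::field \<Rightarrow> 'v::ab_group_add \<Rightarrow> 'v) \<Rightarrow> ('v \<Rightarrow> 'v \<Rightarrow> 'v) \<Rightarrow> 'v set \<Rightarrow>
   ('k \<Rightarrow> 'w::ab_group_add \<Rightarrow> 'w) \<Rightarrow> ('w \<Rightarrow> 'w \<Rightarrow> 'w) \<Rightarrow> ('v set \<Rightarrow> 'w) \<Rightarrow> bool" where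
  "quot_iso scale br J scale' br' \<phi> \<longleftrightarrow>
     bij_betw \<phi> (quot_carrier J) UNIV \<and>
     (\<forall>A\<in>quot_carrier J. \<forall>B\<in>quot_carrier J. \<phi> (A + B) = \<phi> A + \<phi> B) \<and>
     (\<forall>c. \<forall>A\<in>quot_carrier J. \<phi> (quot_scale scale J c A) = scale' c (\<phi> A)) \<and>
     (\<forall>A\<in>quot_carrier J. \<forall>B\<in>quot_carrier J. \<phi> (quot_br br J A B) = br' (\<phi> A) (\<phi> B))"

text \<open>\<open>J\<close> carries the action \<open>(i, x +o J) \<mapsto> br i x\<close> of the quotient, which is identified via \<open>\<phi>\<close>
  with the algebra acting on the target module by \<open>act\<close>.\<close>

definition ideal_module_iso ::
  "('k::field \<Rightarrow> 'v::ab_group_add \<Rightarrow> 'v) \<Rightarrow> ('v \<Rightarrow> 'v \<Rightarrow> 'v) \<Rightarrow> 'v set \<Rightarrow> ('v set \<Rightarrow> 'w) \<Rightarrow>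
   ('k \<Rightarrow> 'm::ab_group_add \<Rightarrow> 'm) \<Rightarrow> ('m \<Rightarrow> 'w \<Rightarrow> 'm) \<Rightarrow> ('v \<Rightarrow> 'm) \<Rightarrow> bool" where
  "ideal_module_iso scale br J \<phi> scaleM act \<theta> \<longleftrightarrow>
     bij_betw \<theta> J UNIV \<and>
     (\<forall>i\<in>J. \<forall>j\<in>J. \<theta> (i + j) = \<theta> i + \<theta> j) \<and>
     (\<forall>c. \<forall>i\<in>J. \<theta> (scale c i) = scaleM c (\<theta> i)) \<and>
     (\<forall>i\<in>J. \<forall>x. \<theta> (br i x) = act (\<theta> i) (\<phi> (x +o J)))"


text \<open>Elements of \<open>H\<^sub>3\<close> are coordinate triples with respect to the basis
  \<open>1\<close>, \<open>x\<close>, \<open>\<delta>/\<delta>x\<close>, in this order.\<close>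

type_synonym 'k h3 = "'k \<times> 'k \<times> 'k"

fun h3_scale :: "'k::field \<Rightarrow> 'k h3 \<Rightarrow> 'k h3" where
  "h3_scale r (a, b, c) = (r * a, r * b, r * c)"

fun h3_br :: "'k::field h3 \<Rightarrow> 'k h3 \<Rightarrow> 'k h3" where
  "h3_br (a, b, c) (a', b', c') = (b * c' - c * b', 0, 0)"

abbreviation h3_one :: "'k::field h3" where "h3_one \<equiv> (1, 0, 0)"
abbreviation h3_x :: "'k::field h3" where "h3_x \<equiv> (0, 1, 0)"
abbreviation h3_d :: "'k::field h3" where "h3_d \<equiv> (0, 0, 1)"

fun psi1 :: "('k::field poly \<Rightarrow> 'k poly) \<Rightarrow> 'k poly \<Rightarrow> 'k h3 \<Rightarrow> 'k poly" where
  "psi1 \<Omega> p (a, b, c) = smult a (\<Omega> p) + smult b ([:0, 1:] * p) + smult c (pderiv p)"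

lemma psi1_basis:
  "psi1 \<Omega> p h3_one = \<Omega> p" "psi1 \<Omega> p h3_x = [:0, 1:] * p" "psi1 \<Omega> p h3_d = pderiv p"
  by simp_all


text \<open>Elements of \<open>HFL\<^sub>3\<close> are coordinate triples as above together with a polynomial, whose
  coefficients are the coordinates with respect to the basis elements \<open>x\<^sup>t\<close>. The bracket is the
  bilinear extension of the multiplication table recorded below.\<close>

type_synonym 'k hfl3 = "'k h3 \<times> 'k poly"

fun hfl3_scale :: "'k::field \<Rightarrow> 'k hfl3 \<Rightarrow> 'k hfl3" where
  "hfl3_scale r (g, p) = (h3_scale r g, smult r p)"

fun hfl3_br :: "'k::field hfl3 \<Rightarrow> 'k hfl3 \<Rightarrow> 'k hfl3" where
  "hfl3_br ((a, b, c), p) ((a', b', c'), q) =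
     ((b * c' - c * b', 0, 0), smult a' p + smult b' ([:0, 1:] * p) + smult c' (pderiv p))"

abbreviation hfl3_one :: "'k::field hfl3" where "hfl3_one \<equiv> (h3_one, 0)"
abbreviation hfl3_x :: "'k::field hfl3" where "hfl3_x \<equiv> (h3_x, 0)"
abbreviation hfl3_d :: "'k::field hfl3" where "hfl3_d \<equiv> (h3_d, 0)"
abbreviation hfl3_pow :: "nat \<Rightarrow> 'k::field hfl3" where "hfl3_pow t \<equiv> (0, monom 1 t)"

lemma hfl3_basis_products:
  "hfl3_br hfl3_x hfl3_d = hfl3_one"
  "hfl3_br hfl3_d hfl3_x = - hfl3_one"
  "hfl3_br (hfl3_pow t) hfl3_one = hfl3_pow t"
  "hfl3_br (hfl3_pow t) hfl3_x = hfl3_pow (t + 1)"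
  "hfl3_br (hfl3_pow t) hfl3_d = hfl3_scale (of_nat t) (hfl3_pow (t - 1))"
  "hfl3_br hfl3_one hfl3_one = 0" "hfl3_br hfl3_one hfl3_x = 0" "hfl3_br hfl3_one hfl3_d = 0"
  "hfl3_br hfl3_x hfl3_one = 0" "hfl3_br hfl3_x hfl3_x = 0"
  "hfl3_br hfl3_d hfl3_one = 0" "hfl3_br hfl3_d hfl3_d = 0"
  "hfl3_br hfl3_one (hfl3_pow t) = 0" "hfl3_br hfl3_x (hfl3_pow t) = 0"
  "hfl3_br hfl3_d (hfl3_pow t) = 0" "hfl3_br (hfl3_pow s) (hfl3_pow t) = 0"
  by (simp_all add: zero_prod_def monom_Suc pderiv_monom smult_monom)

lemma hfl3_basis_expansion:
  "((a, b, c), p) = hfl3_scale a hfl3_one + hfl3_scale b hfl3_x + hfl3_scale c hfl3_d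
     + (\<Sum>t\<le>degree p. hfl3_scale (coeff p t) (hfl3_pow t))" (is "?l = ?r")
proof -
  have "(\<Sum>t\<in>A. hfl3_scale (coeff p t) (hfl3_pow t)) = (0, \<Sum>t\<in>A. monom (coeff p t) t)" for A
    by (induction A rule: infinite_finite_induct) (simp_all add: zero_prod_def smult_monom)
  then show ?thesis by (simp add: poly_as_sum_of_monoms zero_prod_def)
qed


definition obtained_from_psi1 ::
  "('k::field \<Rightarrow> 'v::ab_group_add \<Rightarrow> 'v) \<Rightarrow> ('v \<Rightarrow> 'v \<Rightarrow> 'v) \<Rightarrow> bool" where
  "obtained_from_psi1 scale br \<longleftrightarrow>
     (\<exists>\<phi> \<Omega> \<theta>.
        quot_iso scale br (squares_ideal scale br) h3_scale h3_br \<phi> \<and>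
        Vector_Spaces.linear smult smult \<Omega> \<and>
        lie_right_module h3_scale h3_br smult (psi1 \<Omega>) \<and>
        ideal_module_iso scale br (squares_ideal scale br) \<phi> smult (psi1 \<Omega>) \<theta>)"

end

theory Submission
  imports Defs
begin

text \<open>Let \<open>J\<close> be the ideal of squares of \<open>L\<close>, \<open>\<pi> : L \<rightarrow> H\<^sub>3\<close> the quotient map and \<open>e\<close> a lift of the
  central element \<open>1\<close>. The module law for \<open>[x, \<delta>/\<delta>x] = 1\<close> forces \<open>\<Omega>\<close> to be the identity, so \<open>e\<close>
  acts on \<open>J\<close> as the identity, while \<open>[v, e] \<in> J\<close> for all \<open>v\<close> because \<open>1\<close> is central. Hence
  \<open>v \<mapsto> [v, e]\<close> is a projection of \<open>L\<close> onto \<open>J\<close>, and \<open>v \<mapsto> (\<pi> v, [v, e])\<close> is a linear bijection onto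
  \<open>H\<^sub>3 \<times> J\<close>. It preserves brackets because
  \<open>[[v, w], e] = [[v, e], w] + [v, [w, e]] = [[v, e], w]\<close>, using \<open>[L, J] = 0\<close>.\<close>

section \<open>The model algebra on \<open>H\<^sub>3\<close> and polynomials\<close>

lemma h3_vector_space: "vector_space (h3_scale :: 'k::field \<Rightarrow> 'k h3 \<Rightarrow> 'k h3)"
  by unfold_locales (auto simp: algebra_simps)

lemma smult_vector_space: "vector_space (smult :: 'k::field \<Rightarrow> 'k poly \<Rightarrow> 'k poly)"
  by unfold_locales (auto simp: smult_add_right smult_add_left)

lemma hfl3_vector_space: "vector_space (hfl3_scale :: 'k::field \<Rightarrow> 'k hfl3 \<Rightarrow> 'k hfl3)"
  by unfold_locales (auto simp: algebra_simps smult_add_right smult_add_left)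

lemma hfl3_scale_eq: "hfl3_scale c u = (h3_scale c (fst u), smult c (snd u))"
  by (cases u) simp

text \<open>Exhibits the bracket as a hemisemidirect product: the left polynomial is acted on by the
  Heisenberg part of the right factor, whose own polynomial does not enter. Laws for
  \<open>hfl3_br\<close> then split into a law of \<open>h3_br\<close> and a module law.\<close>

lemma hfl3_br_eq: "hfl3_br u v = (h3_br (fst u) (fst v), psi1 id (snd u) (fst v))"
  by (cases u; cases v) auto

lemma h3_lie_algebra: "lie_algebra (h3_scale :: 'k::field \<Rightarrow> 'k h3 \<Rightarrow> 'k h3) h3_br"
  unfolding lie_algebra_def leibniz_algebra_def leibniz_algebra_axioms_def lie_algebra_axioms_def
    Vector_Spaces.linear_iff
  using h3_vector_space by (auto simp: algebra_simps zero_prod_def)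

lemma psi1_id_module:
  "lie_right_module (h3_scale :: 'k::field \<Rightarrow> 'k h3 \<Rightarrow> 'k h3) h3_br smult (psi1 id)"
proof (intro lie_right_module.intro lie_right_module_axioms.intro)
  fix p :: "'k poly" and g h :: "'k h3"
  have sum: "psi1 id (p + q) g = psi1 id p g + psi1 id q g" for p q :: "'k poly" and g
    by (cases g) (simp add: smult_add_right pderiv_add distrib_left flip: add_pCons)
  have scale: "psi1 id (smult c p) g = smult c (psi1 id p g)" for c and p :: "'k poly" and g
    by (cases g) (simp add: smult_add_right pderiv_smult mult.commute)
  show "Vector_Spaces.linear smult smult (\<lambda>p. psi1 id p g)"
    unfolding Vector_Spaces.linear_iff using smult_vector_space sum scale by blast
  have "psi1 id p (g + h) = psi1 id p g + psi1 id p h" for g h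
    by (cases g; cases h) (simp add: smult_add_left)
  moreover have "psi1 id p (h3_scale c g) = smult c (psi1 id p g)" for c g
    by (cases g) (simp add: smult_add_right)
  ultimately show "Vector_Spaces.linear h3_scale smult (psi1 id p)"
    unfolding Vector_Spaces.linear_iff using h3_vector_space smult_vector_space by blast
  \<comment> \<open>By bilinearity this reduces to the Weyl relation (x p)' - x p' = p, verified
    coefficient by coefficient.\<close>
  show "psi1 id p (h3_br g h) = psi1 id (psi1 id p g) h - psi1 id (psi1 id p h) g"
  proof (cases g; cases h)
    fix a b c a' b' c' assume "g = (a, b, c)" "h = (a', b', c')"
    then show ?thesis
      by (intro poly_eqI)
        (simp add: coeff_pderiv coeff_pCons algebra_simps split: nat.split)
  qed
qed (use h3_lie_algebra smult_vector_space in \<open>auto simp: lie_algebra_def\<close>)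

lemma hfl3_leibniz_algebra:
  "leibniz_algebra (hfl3_scale :: 'k::field \<Rightarrow> 'k hfl3 \<Rightarrow> 'k hfl3) hfl3_br"
proof -
  interpret H: lie_algebra "h3_scale :: 'k \<Rightarrow> 'k h3 \<Rightarrow> 'k h3" h3_br by (rule h3_lie_algebra)
  interpret P: lie_right_module "h3_scale :: 'k \<Rightarrow> 'k h3 \<Rightarrow> 'k h3" h3_br smult "psi1 id"
    by (rule psi1_id_module)
  show ?thesis
  proof (intro leibniz_algebra.intro leibniz_algebra_axioms.intro hfl3_vector_space)
    fix u v w :: "'k hfl3"
    show "Vector_Spaces.linear hfl3_scale hfl3_scale (\<lambda>u. hfl3_br u v)"
      using H.linear_br_left[of "fst v"] P.linear_act_left[of "fst v"] hfl3_vector_space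
      unfolding Vector_Spaces.linear_iff by (simp add: hfl3_br_eq hfl3_scale_eq)
    show "Vector_Spaces.linear hfl3_scale hfl3_scale (hfl3_br u)"
      using H.linear_br_right[of "fst u"] P.linear_act_right[of "snd u"] hfl3_vector_space
      unfolding Vector_Spaces.linear_iff by (simp add: hfl3_br_eq hfl3_scale_eq)
    \<comment> \<open>The second component is the module law \<open>act_br\<close> with one term
      moved across.\<close>
    show "hfl3_br (hfl3_br u v) w = hfl3_br (hfl3_br u w) v + hfl3_br u (hfl3_br v w)"
      using H.leibniz[of "fst u" "fst v" "fst w"] P.act_br[of "snd u" "fst v" "fst w"]
      by (simp add: hfl3_br_eq)
  qed
qed

text \<open>The module law at \<open>h3_x\<close>, \<open>h3_d\<close> reads \<open>\<Omega>\<close>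
  p = (x p)' - x p', and the product rule turns the right side into p.\<close>

lemma psi1_module_imp_id:
  assumes "lie_right_module (h3_scale :: 'k::field \<Rightarrow> 'k h3 \<Rightarrow> 'k h3) h3_br smult (psi1 \<Omega>)"
  shows "\<Omega> = id"
proof
  fix p
  interpret lie_right_module "h3_scale :: 'k \<Rightarrow> 'k h3 \<Rightarrow> 'k h3" h3_br smult "psi1 \<Omega>"
    by (rule assms)
  from act_br[of p h3_x h3_d] show "\<Omega> p = id p"
    by (simp add: pderiv_pCons)
qed

section \<open>The ideal generated by the squares\<close>

context leibniz_algebra
begin

lemmas br_add_left = linear_br_left[unfolded Vector_Spaces.linear_iff, THEN conjunct2, THEN conjunct2,
    THEN conjunct1, rule_format]
lemmas br_scale_left = linear_br_left[unfolded Vector_Spaces.linear_iff, THEN conjunct2,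
    THEN conjunct2, THEN conjunct2, rule_format]
lemmas br_add_right = linear_br_right[unfolded Vector_Spaces.linear_iff, THEN conjunct2,
    THEN conjunct2, THEN conjunct1, rule_format]
lemmas br_scale_right = linear_br_right[unfolded Vector_Spaces.linear_iff, THEN conjunct2,
    THEN conjunct2, THEN conjunct2, rule_format]

lemma br_zero_left [simp]: "br 0 x = 0"
  using br_add_left[of 0 0 x] by simp

lemma br_zero_right [simp]: "br x 0 = 0"
  using br_add_right[of x 0 0] by simp

lemma br_diff_left: "br (x - y) z = br x z - br y z"
  using br_add_left[of "x - y" y z] by (simp add: algebra_simps)

lemma squares_ideal_is_ideal: "leibniz_ideal scale br (squares_ideal scale br)"
  unfolding squares_ideal_def leibniz_ideal_def by (auto simp: subspace_def)

lemma squares_ideal_minimal: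
  assumes "leibniz_ideal scale br K" "\<And>x. br x x \<in> K"
  shows "squares_ideal scale br \<subseteq> K"
  using assms unfolding squares_ideal_def by auto

lemma square_in_squares_ideal: "br x x \<in> squares_ideal scale br"
  unfolding squares_ideal_def by auto

text \<open>The vectors z with [y, z] = 0 for all y form an ideal, and the Leibniz identity with two
  equal arguments puts every square in it. Minimality of the ideal of squares finishes.\<close>

lemma br_squares_ideal_right:
  assumes "i \<in> squares_ideal scale br"
  shows "br y i = 0"
proof -
  let ?K = "{z. \<forall>y. br y z = 0}"
  have "br y (br z x) = 0" "br y (br x z) = 0" if "z \<in> ?K" for x y z
    using that leibniz[of y z x] leibniz[of y x z] by simp_all
  then have "leibniz_ideal scale br ?K"
    unfolding leibniz_ideal_def subspace_def by (auto simp: br_add_right br_scale_right)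
  moreover have "br x x \<in> ?K" for x
    using leibniz[of _ x x] by simp
  ultimately show ?thesis
    using squares_ideal_minimal assms by blast
qed

end

section \<open>Calculus of cosets of an ideal\<close>

locale leibniz_with_ideal = leibniz_algebra +
  fixes J
  assumes ideal: "leibniz_ideal scale br J"
begin

lemma subspace: "subspace J"
  using ideal unfolding leibniz_ideal_def by blast

lemma br_ideal: "j \<in> J \<Longrightarrow> br j x \<in> J" "j \<in> J \<Longrightarrow> br x j \<in> J"
  using ideal unfolding leibniz_ideal_def by blast+

lemma mem_coset: "y \<in> x +o J \<longleftrightarrow> y - x \<in> J"
  unfolding elt_set_plus_def by (auto intro: bexI[of _ "y - x"])

lemma self_in_coset: "x \<in> x +o J"
  using mem_coset subspace_0[OF subspace] by simp

lemma coset_eq_iff: "x +o J = y +o J \<longleftrightarrow> x - y \<in> J"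
proof
  assume "x +o J = y +o J"
  then show "x - y \<in> J" using self_in_coset[of x] mem_coset by simp
next
  assume d: "x - y \<in> J"
  have "z - x \<in> J \<longleftrightarrow> z - y \<in> J" for z
    using subspace_add[OF subspace d, of "z - x"] subspace_diff[OF subspace _ d, of "z - y"] by auto
  then show "x +o J = y +o J" using mem_coset by auto
qed

text \<open>Elementwise operations may yield only a part of a coset. Adding \<open>J\<close> fills
  it up as soon as that part contains the representative.\<close>

lemma coset_plus_ideal:
  assumes "A \<subseteq> x +o J" "x \<in> A"
  shows "A + J = x +o J"
proof (intro equalityI subsetI)
  fix z assume "z \<in> A + J"
  then obtain a j where "z = a + j" "a \<in> A" "j \<in> J" by (auto simp: set_plus_def)
  moreover from this have "a - x \<in> J" using assms mem_coset by blast
  ultimately have "(a - x) + j \<in> J" using subspace_add[OF subspace] by blast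
  then show "z \<in> x +o J" using \<open>z = a + j\<close> mem_coset by (simp add: algebra_simps)
next
  fix z assume "z \<in> x +o J"
  then show "z \<in> A + J" using assms(2) by (auto simp: set_plus_def elt_set_plus_def)
qed

lemma coset_add: "(x +o J) + (y +o J) = (x + y) +o J"
proof -
  have "J + J = J"
    using coset_plus_ideal[of J 0] subspace_0[OF subspace] by simp
  then show ?thesis by (simp add: set_plus_rearrange)
qed

lemma coset_scale: "quot_scale scale J c (x +o J) = scale c x +o J"
  unfolding quot_scale_def
proof (rule coset_plus_ideal)
  show "scale c ` (x +o J) \<subseteq> scale c x +o J"
    using subspace_scale[OF subspace] mem_coset
    by (auto simp flip: scale_right_diff_distrib)
qed (use self_in_coset in blast)

lemma coset_br: "quot_br br J (x +o J) (y +o J) = br x y +o J"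
  unfolding quot_br_def
proof (rule coset_plus_ideal)
  \<comment> \<open>For i and j in \<open>J\<close>, each term on the right has a factor in
    \<open>J\<close>.\<close>
  have "br (x + i) (y + j) - br x y = br i (y + j) + br x j" for i j
    by (simp add: br_add_left br_add_right)
  then show "{br a b |a b. a \<in> x +o J \<and> b \<in> y +o J} \<subseteq> br x y +o J"
    using subspace_add[OF subspace] br_ideal mem_coset unfolding elt_set_plus_def
    by fastforce
qed (use self_in_coset in blast)

text \<open>Trades operations on cosets for operations on representatives, so that only the
  composite of \<open>\<phi>\<close> with the projection to cosets has to be handled.\<close>

lemma quot_iso_iff:
  "quot_iso scale br J scale' br' \<phi> \<longleftrightarrow>
     (\<forall>x y. \<phi> (x +o J) = \<phi> (y +o J) \<longrightarrow> x - y \<in> J) \<and> surj (\<lambda>x. \<phi> (x +o J)) \<and>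
     (\<forall>x y. \<phi> ((x + y) +o J) = \<phi> (x +o J) + \<phi> (y +o J)) \<and>
     (\<forall>c x. \<phi> (scale c x +o J) = scale' c (\<phi> (x +o J))) \<and>
     (\<forall>x y. \<phi> (br x y +o J) = br' (\<phi> (x +o J)) (\<phi> (y +o J)))"
  unfolding quot_iso_def bij_betw_def inj_on_def quot_carrier_def
  by (simp add: coset_add coset_scale coset_br coset_eq_iff image_image)

end

section \<open>Algebras obtained from the action are isomorphic to the model\<close>

lemma obtained_imp_isomorphic:
  fixes scale :: "'k::field \<Rightarrow> 'v::ab_group_add \<Rightarrow> 'v"
  assumes "leibniz_algebra scale br" and "obtained_from_psi1 scale br"
  shows "leibniz_isomorphic scale br hfl3_scale hfl3_br"
proof -
  interpret leibniz_algebra scale br by fact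
  define J where "J = squares_ideal scale br"
  interpret leibniz_with_ideal scale br J
    by unfold_locales (simp add: J_def squares_ideal_is_ideal)
  obtain \<phi> \<Omega> \<theta> where \<phi>: "quot_iso scale br J h3_scale h3_br \<phi>"
    and "lie_right_module h3_scale h3_br smult (psi1 \<Omega>)"
    and "ideal_module_iso scale br J \<phi> smult (psi1 \<Omega>) \<theta>"
    using assms(2) unfolding obtained_from_psi1_def J_def by blast
  with psi1_module_imp_id have \<theta>: "ideal_module_iso scale br J \<phi> smult (psi1 id) \<theta>"
    by blast
  define \<pi> where "\<pi> x = \<phi> (x +o J)" for x
  have \<pi>_eqD: "x - y \<in> J" if "\<pi> x = \<pi> y" for x y
    using \<phi> that unfolding quot_iso_iff \<pi>_def by blast
  have surj_\<pi>: "surj \<pi>"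
    using \<phi> unfolding quot_iso_iff \<pi>_def by blast
  have \<pi>_add: "\<pi> (x + y) = \<pi> x + \<pi> y" and \<pi>_scale: "\<pi> (scale c x) = h3_scale c (\<pi> x)"
    and \<pi>_br: "\<pi> (br x y) = h3_br (\<pi> x) (\<pi> y)" for x y c
    using \<phi> unfolding quot_iso_iff \<pi>_def by blast+
  have \<pi>_0: "\<pi> 0 = 0"
    using \<pi>_add[of 0 0] by simp
  have \<pi>_diff: "\<pi> (x - y) = \<pi> x - \<pi> y" for x y
    using \<pi>_add[of "x - y" y] by (simp add: algebra_simps)
  have \<pi>_J: "\<pi> i = 0" if "i \<in> J" for i
    using that coset_eq_iff[of i 0] \<pi>_0 unfolding \<pi>_def by simp
  have bij_\<theta>: "bij_betw \<theta> J UNIV"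
    and \<theta>_add: "\<lbrakk>i \<in> J; j \<in> J\<rbrakk> \<Longrightarrow> \<theta> (i + j) = \<theta> i + \<theta> j"
    and \<theta>_scale: "i \<in> J \<Longrightarrow> \<theta> (scale c i) = smult c (\<theta> i)"
    and \<theta>_br: "i \<in> J \<Longrightarrow> \<theta> (br i x) = psi1 id (\<theta> i) (\<pi> x)" for i j c x
    using \<theta> unfolding ideal_module_iso_def \<pi>_def by blast+
  have inj_\<theta>: "i = j" if "\<theta> i = \<theta> j" "i \<in> J" "j \<in> J" for i j
    using bij_\<theta> that unfolding bij_betw_def inj_on_def by blast
  obtain e where e: "\<pi> e = h3_one"
    using surj_\<pi> by (metis surjD)
  have br_e_J: "br v e \<in> J" for v
  proof -
    \<comment> \<open>\<open>h3_one\<close> is central, and \<open>\<pi>_eqD\<close> applied to the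
      pair \<open>br v e\<close>, \<open>0\<close> gives membership in \<open>J\<close>.\<close>
    have "\<pi> (br v e) = \<pi> 0"
      unfolding \<pi>_br e \<pi>_0 by (cases "\<pi> v") (simp add: zero_prod_def)
    from \<pi>_eqD[OF this] show ?thesis by simp
  qed
  have br_e_id: "br i e = i" if "i \<in> J" for i
    using \<theta>_br[OF that, of e] e br_ideal(1)[OF that] that by (intro inj_\<theta>) simp_all
  \<comment> \<open>\<open>\<theta>\<close> is controlled only on \<open>J\<close>; by
    \<open>br_e_J\<close> it is applied only there.\<close>
  define f where "f v = (\<pi> v, \<theta> (br v e))" for v
  have f_add: "f (x + y) = f x + f y" and f_scale: "f (scale c x) = hfl3_scale c (f x)" for c x y
    by (simp_all add: f_def \<pi>_add \<pi>_scale br_add_left br_scale_left \<theta>_add \<theta>_scale br_e_J)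
  have f_br: "f (br v w) = hfl3_br (f v) (f w)" for v w
  proof -
    have "br (br v w) e = br (br v e) w"
      using leibniz[of v w e] br_squares_ideal_right br_e_J unfolding J_def by simp
    then show ?thesis
      by (simp add: f_def hfl3_br_eq \<pi>_br \<theta>_br br_e_J)
  qed
  have "inj f"
  proof (rule injI)
    fix x y assume "f x = f y"
    then have "x - y \<in> J" and *: "br x e = br y e"
      using \<pi>_eqD br_e_J inj_\<theta> unfolding f_def by auto
    \<comment> \<open>On \<open>J\<close> bracketing with \<open>e\<close> is the identity, so x - y
      = [x - y, e] = [x, e] - [y, e] = 0.\<close>
    then show "x = y"
      using br_e_id[of "x - y"] by (simp add: br_diff_left)
  qed
  moreover have "\<exists>v. u = f v" for u
  proof -
    obtain v where v: "\<pi> v = fst u" using surj_\<pi> by (metis surjD)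
    obtain i where i: "i \<in> J" "\<theta> i = snd u" using bij_\<theta> unfolding bij_betw_def by (metis UNIV_I imageE)
    \<comment> \<open>Subtracting \<open>br v e\<close> clears the \<open>J\<close>-part of
      \<open>v\<close> without changing \<open>\<pi> v\<close>; adding \<open>i\<close> then
      installs the wanted one.\<close>
    have "f (v - br v e + i) = u"
      using v i
      by (simp add: f_def \<pi>_add \<pi>_diff \<pi>_J br_add_left br_diff_left br_e_J br_e_id)
    then show ?thesis by metis
  qed
  ultimately have "bij f" by (simp add: bij_def surj_def)
  with f_add f_scale f_br have "leibniz_iso scale br hfl3_scale hfl3_br f"
    unfolding leibniz_iso_def Vector_Spaces.linear_iff
    using vector_space_axioms hfl3_vector_space by blast
  then show ?thesis unfolding leibniz_isomorphic_def by blast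
qed

section \<open>Copies of the model arise from the action\<close>

lemma isomorphic_imp_obtained:
  fixes scale :: "'k::field \<Rightarrow> 'v::ab_group_add \<Rightarrow> 'v"
  assumes "leibniz_algebra scale br" and "leibniz_isomorphic scale br hfl3_scale hfl3_br"
  shows "obtained_from_psi1 scale br"
proof -
  interpret leibniz_algebra scale br by fact
  obtain f where "Vector_Spaces.linear scale hfl3_scale f" and bij: "bij f"
    and f_br: "\<And>x y. f (br x y) = hfl3_br (f x) (f y)"
    using assms(2) unfolding leibniz_isomorphic_def leibniz_iso_def by blast
  then have f_add: "\<And>x y. f (x + y) = f x + f y"
    and f_scale: "\<And>c x. f (scale c x) = hfl3_scale c (f x)"
    unfolding Vector_Spaces.linear_iff by blast+
  have f_0: "f 0 = 0" using f_add[of 0 0] by simp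
  have f_diff: "f (x - y) = f x - f y" for x y
    using f_add[of "x - y" y] by (simp add: algebra_simps)
  have f_inv: "f (inv f u) = u" for u
    using bij by (simp add: bij_is_surj surj_f_inv_f)
  have inj: "x = y" if "f x = f y" for x y
    using bij that by (simp add: bij_def inj_eq)
  define \<pi> where "\<pi> v = fst (f v)" for v
  \<comment> \<open>The kernel of \<open>\<pi>\<close> is visibly an ideal in coordinates; it is
    identified with the ideal of squares below.\<close>
  define J where "J = {v. \<pi> v = 0}"
  have h3_br_self: "h3_br a a = 0" for a :: "'k h3"
    by (cases a) (simp add: zero_prod_def)
  have h3_br_0: "h3_br 0 a = 0" "h3_br a 0 = 0" "h3_scale c 0 = 0" for a :: "'k h3" and c
    by (cases a; simp add: zero_prod_def)+
  have ideal: "leibniz_ideal scale br J"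
    unfolding leibniz_ideal_def subspace_def J_def \<pi>_def
    by (simp add: f_0 f_add f_scale f_br hfl3_br_eq hfl3_scale_eq h3_br_0)
  interpret leibniz_with_ideal scale br J
    by unfold_locales (rule ideal)
  have "squares_ideal scale br \<subseteq> J"
    by (rule squares_ideal_minimal[OF ideal]) (simp add: J_def \<pi>_def f_br hfl3_br_eq h3_br_self)
  \<comment> \<open>\<open>(0, p)\<close> is the square of \<open>(1, p)\<close>.\<close>
  moreover have "v \<in> squares_ideal scale br" if "v \<in> J" for v
  proof -
    define u where "u = inv f (h3_one, snd (f v))"
    have "f (br u u) = f v"
      using that
      by (simp add: f_br u_def f_inv hfl3_br_eq J_def \<pi>_def prod_eq_iff)
    then show ?thesis using inj square_in_squares_ideal by metis
  qed
  ultimately have J: "squares_ideal scale br = J" by blast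
  \<comment> \<open>\<open>\<phi>\<close> must accept a set, so a representative is chosen; the
    choice is harmless because \<open>\<pi>\<close> is constant on cosets of its kernel
    \<open>J\<close>.\<close>
  define \<phi> where "\<phi> A = \<pi> (SOME a. a \<in> A)" for A
  have \<phi>: "\<phi> (x +o J) = \<pi> x" for x
  proof -
    have "(SOME a. a \<in> x +o J) - x \<in> J"
      using someI[of "\<lambda>a. a \<in> x +o J", OF self_in_coset] mem_coset by blast
    then show ?thesis by (simp add: \<phi>_def J_def \<pi>_def f_diff)
  qed
  have "surj \<pi>"
    by (rule surjI[of _ "\<lambda>h. inv f (h, 0)"]) (simp add: \<pi>_def f_inv)
  then have "quot_iso scale br J h3_scale h3_br \<phi>"
    unfolding quot_iso_iff \<phi>
    by (simp add: J_def) (simp add: \<pi>_def f_diff f_add f_scale f_br hfl3_br_eq hfl3_scale_eq)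
  moreover have "ideal_module_iso scale br J \<phi> smult (psi1 id) (\<lambda>v. snd (f v))"
  proof -
    have "bij_betw (\<lambda>v. snd (f v)) J UNIV"
      by (rule bij_betw_byWitness[where f' = "\<lambda>p. inv f (0, p)"])
        (auto simp: J_def \<pi>_def f_inv prod_eq_iff intro!: inj)
    then show ?thesis
      unfolding ideal_module_iso_def \<phi>
      by (simp add: \<pi>_def f_add f_scale f_br hfl3_br_eq hfl3_scale_eq)
  qed
  moreover have "Vector_Spaces.linear smult smult (id :: 'k poly \<Rightarrow> _)"
    unfolding Vector_Spaces.linear_iff using smult_vector_space by auto
  ultimately show ?thesis
    unfolding obtained_from_psi1_def J using psi1_id_module by blast
qed

text \<open>The equivalence speaks of algebras on one carrier type \<open>'v\<close>, which may
  differ from that of the model; membership of the model itself is therefore stated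
  separately.\<close>

theorem proposition1:
  shows "leibniz_algebra (hfl3_scale :: 'k::{alg_closed_field, field_char_0} \<Rightarrow> 'k hfl3 \<Rightarrow> 'k hfl3) hfl3_br
    \<and> obtained_from_psi1 (hfl3_scale :: 'k \<Rightarrow> 'k hfl3 \<Rightarrow> 'k hfl3) hfl3_br
    \<and> (\<forall>(scale :: 'k \<Rightarrow> 'v::ab_group_add \<Rightarrow> 'v) (br :: 'v \<Rightarrow> 'v \<Rightarrow> 'v). leibniz_algebra scale br \<longrightarrow>
          (obtained_from_psi1 scale br \<longleftrightarrow> leibniz_isomorphic scale br hfl3_scale hfl3_br))"
proof -
  \<comment> \<open>The identity makes the model a copy of itself, so the converse direction shows
    that it arises from the action.\<close>
  have "leibniz_iso (hfl3_scale :: 'k \<Rightarrow> 'k hfl3 \<Rightarrow> 'k hfl3) hfl3_br hfl3_scale hfl3_br id"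
    unfolding leibniz_iso_def Vector_Spaces.linear_iff using hfl3_vector_space by auto
  then have "obtained_from_psi1 (hfl3_scale :: 'k \<Rightarrow> 'k hfl3 \<Rightarrow> 'k hfl3) hfl3_br"
    using isomorphic_imp_obtained hfl3_leibniz_algebra unfolding leibniz_isomorphic_def by blast
  then show ?thesis
    using hfl3_leibniz_algebra obtained_imp_isomorphic isomorphic_imp_obtained by blast
qed

end
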